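(* Let $B\subset\mathbb{H}$ be nonempty and suppose there exists $\alpha>1$ such that $$\Big|B\setminus\{x\in\mathbb{H}:\ x_2\le |x_1|^{1/\alpha}\}\Big|<\infty.$$ Then there exists $x\in B$ with $\bar{\mathcal H}_B(x)>0$.
   Context: $\mathbb{H}=\{(x_1,x_2)\in\mathbb{Z}^2:\ x_2\ge 0\}$ and $L_n=\{(x_1,n):x_1\in\mathbb{Z}\}$. $(S_n)_{n\ge0}$ is a simple random walk on $\mathbb{Z}^2$; $P_z$ denotes its law started at $z$. For $A\subset\mathbb{Z}^2$, $\bar\tau_A=\min\{n\ge0: S_n\in A\}$. For $B\subset\mathbb{H}$, $x\in B$ and $N\ge1$, define $$\bar{\mathcal H}_{B,N}(x)=\sum_{z\in L_N\setminus B}P_z\big(S_{\bar\tau_{B\cup L_0}}=x\big).$$ It is known that the limit $\bar{\mathcal H}_B(x)=\lim_{N\to\infty}\bar{\mathcal H}_{B,N}(x)$ exists and is finite for every $B\subset\mathbb{H}$ and $x\in B$; it is called the stationary harmonic measure of $x$ with respect to $B$. $|\cdot|$ of a set denotes its cardinality. *)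

theory Defs
  imports "HOL-Probability.Probability"
begin

type_synonym pt = "int \<times> int"

definition HH :: "pt set" where "HH = {x. snd x \<ge> 0}"
definition line :: "int \<Rightarrow> pt set" where "line n = {x. snd x = n}"

definition srw_steps :: "pt pmf" where
  "srw_steps = pmf_of_set {(1,0), (-1,0), (0,1), (0,-1)}"

definition srw_space :: "pt stream measure" where
  "srw_space = stream_space (measure_pmf srw_steps)"

definition walk :: "pt \<Rightarrow> pt stream \<Rightarrow> nat \<Rightarrow> pt" where
  "walk z \<omega> n = (fst z + (\<Sum>i<n. fst (\<omega> !! i)), snd z + (\<Sum>i<n. snd (\<omega> !! i)))"

definition hit_prob :: "pt \<Rightarrow> pt set \<Rightarrow> pt \<Rightarrow> ennreal" where
  "hit_prob z A x = emeasure srw_space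
     {\<omega> \<in> space srw_space. \<exists>n. walk z \<omega> n \<in> A \<and> walk z \<omega> n = x \<and> (\<forall>m<n. walk z \<omega> m \<notin> A)}"

definition Hbar_N :: "pt set \<Rightarrow> nat \<Rightarrow> pt \<Rightarrow> ennreal" where
  "Hbar_N B N x = (\<Sum>\<^sub>\<infinity> z \<in> line (int N) - B. hit_prob z (B \<union> line 0) x)"

text \<open>Stationary harmonic measure (the limit is known to exist).\<close>
definition Hbar :: "pt set \<Rightarrow> pt \<Rightarrow> ennreal" where
  "Hbar B x = lim (\<lambda>N. Hbar_N B N x)"

end

theory Submission
  imports Defs "HOL-Real_Asymp.Real_Asymp"
begin

text \<open>
  Put $A = B \cup L_0$. Reversing time turns the sum of hitting probabilities over $L_N$ into the
  expected number of visits to $L_N$ of the walk killed on $A$, started from a neighbour of $x$.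
  This occupation function \<^emph>\<open>green\<close> is the least supersolution of $g = 1_{L_N} + Pg$ off $A$.
  Minimality makes it nonincreasing in $N$ once $N$ lies above the starting point, so the
  limit defining the harmonic measure exists. A strictly superharmonic function $\varphi$ that
  dominates the height on $A$ and is sublinear on the vertical axis gives, by the minimum principle,
  the lower bound $4(\min(N, y) - \varphi)$, which is positive high up on the axis. Positivity passes
  from a point to its neighbours off $A$, hence it reaches a neighbour of a point of $B$.
\<close>

section \<open>Neighbour averages and the occupation function of the killed walk\<close>

definition avg :: "(pt \<Rightarrow> ennreal) \<Rightarrow> pt \<Rightarrow> ennreal" where
  "avg f w = (f (w + (1,0)) + f (w + (-1,0)) + f (w + (0,1)) + f (w + (0,-1))) / 4"

text \<open>
  Decomposing at the last step, \<^emph>\<open>flow A L n w\<close> is the sum over $z \in L$ of the probability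
  that the walk from $z$ is at $w$ at time $n$ without having met $A$.
\<close>

primrec flow :: "pt set \<Rightarrow> pt set \<Rightarrow> nat \<Rightarrow> pt \<Rightarrow> ennreal" where
  "flow A L 0 w = of_bool (w \<in> L - A)"
| "flow A L (Suc n) w = (if w \<in> A then 0 else avg (flow A L n) w)"

definition green :: "pt set \<Rightarrow> pt set \<Rightarrow> pt \<Rightarrow> ennreal" where
  "green A L w = (\<Sum>n. flow A L n w)"

lemma avg_mono: "(\<And>w. f w \<le> g w) \<Longrightarrow> avg f w \<le> avg g w"
  unfolding avg_def by (intro divide_right_mono_ennreal add_mono)

lemma avg_zero [simp]: "avg (\<lambda>_. 0) w = 0"
  by (simp add: avg_def)

lemma avg_add: "avg (\<lambda>w. f w + g w) w = avg f w + avg g w"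
  by (simp add: avg_def divide_ennreal_def algebra_simps)

lemma avg_commute: "avg (\<lambda>u. avg (\<lambda>v. f u v) w) z = avg (\<lambda>v. avg (\<lambda>u. f u v) z) w"
  by (simp add: avg_def divide_ennreal_def algebra_simps)

lemma avg_suminf: "avg (\<lambda>w. \<Sum>n. f n w) w = (\<Sum>n. avg (f n) w)"
  by (simp add: avg_def suminf_add ennreal_suminf_divide)

lemma avg_nn_integral:
  "avg (\<lambda>w. \<integral>\<^sup>+z. f z w \<partial>count_space L) w = (\<integral>\<^sup>+z. avg (f z) w \<partial>count_space L)"
  by (simp add: avg_def nn_integral_add nn_integral_divide)

lemma avg_ge_neighbour:
  assumes "e \<in> {(1,0), (-1,0), (0,1), (0,-1)}"
  shows "f (w + e) / 4 \<le> avg f w"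
  using assms unfolding avg_def by (intro divide_right_mono_ennreal) (auto simp: add_increasing add_increasing2)

lemma nn_integral_srw_steps: "(\<integral>\<^sup>+s. f (z + s) \<partial>measure_pmf srw_steps) = avg f z"
  unfolding srw_steps_def avg_def
  by (subst nn_integral_pmf_of_set) (simp_all add: add.assoc)

text \<open>The step set is closed under negation, so the one-step kernel is symmetric. This
  reversibility is the base case of both inductions on time below.\<close>

lemma avg_of_bool_eq_commute: "avg (\<lambda>u. of_bool (u = z)) w = avg (\<lambda>u. of_bool (u = w)) z"
proof -
  have "w + e = z \<longleftrightarrow> z + - e = w" for e :: pt
    by (auto simp: algebra_simps)
  from this [of "(1,0)"] this [of "(-1,0)"] this [of "(0,1)"] this [of "(0,-1)"] show ?thesis
    unfolding avg_def by (simp add: add_ac)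
qed

text \<open>The recursion is linear in its initial data, and the indicator of \<open>L\<close> is
  the sum of the indicators of its points.\<close>

lemma flow_eq_nn_integral: "flow A L n w = (\<integral>\<^sup>+z. flow A {z} n w \<partial>count_space L)"
proof (induction n arbitrary: w)
  case 0
  have "(\<integral>\<^sup>+z. of_bool (w \<in> {z} - A) \<partial>count_space L) = (\<integral>\<^sup>+z. of_bool (w \<notin> A) * indicator {w} z \<partial>count_space L)"
    by (intro nn_integral_cong) (auto simp: indicator_def)
  also have "\<dots> = of_bool (w \<in> L - A)"
  proof (cases "w \<in> L")
    case True
    then show ?thesis by (simp add: nn_integral_cmult_indicator)
  next
    case False
    then have "(\<integral>\<^sup>+z. of_bool (w \<notin> A) * indicator {w} z \<partial>count_space L) = (\<integral>\<^sup>+z. 0 \<partial>count_space L)"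
      by (intro nn_integral_cong) (auto simp: indicator_def)
    with False show ?thesis by simp
  qed
  finally show ?case by simp
next
  case (Suc n)
  have "flow A L (Suc n) w = (if w \<in> A then 0 else avg (\<lambda>w. \<integral>\<^sup>+z. flow A {z} n w \<partial>count_space L) w)"
    by (simp flip: Suc)
  then show ?case
    by (simp add: avg_nn_integral)
qed

lemma flow_singleton_0: "flow A {z} 0 w = (if z \<in> A then 0 else of_bool (w = z))"
  by auto

text \<open>Averaging over the start and averaging over the endpoint commute, so peeling off the
  first step gives the same kind of recursion as the defining one for the last step. This makes
  \<open>flow\<close> comparable with hitting times, which recurse naturally on the first
  step.\<close>

lemma flow_first_step:
  "flow A {z} (Suc n) w = (if z \<in> A then 0 else avg (\<lambda>z'. flow A {z'} n w) z)"
proof (induction n arbitrary: w)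
  case 0
  have "flow A {z} (Suc 0) w = (if w \<in> A \<or> z \<in> A then 0 else avg (\<lambda>u. of_bool (u = z)) w)"
    by (auto simp: flow_singleton_0 [abs_def])
  moreover have "(\<lambda>z'. flow A {z'} 0 w) = (\<lambda>z'. if w \<in> A then 0 else of_bool (z' = w))"
    by (auto simp: fun_eq_iff)
  ultimately show ?case
    by (simp add: avg_of_bool_eq_commute [of w z])
next
  case (Suc n)
  have "flow A {z} (Suc (Suc n)) w = (if w \<in> A then 0 else avg (\<lambda>u. flow A {z} (Suc n) u) w)"
    by (simp add: avg_def)
  also have "\<dots> = (if z \<in> A then 0 else if w \<in> A then 0 else avg (\<lambda>z'. avg (\<lambda>u. flow A {z'} n u) w) z)"
    unfolding Suc using avg_commute [of "\<lambda>z' u. flow A {z'} n u" w z] by simp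
  finally show ?case by (simp add: avg_def)
qed

lemma green_unfold: "green A L w = (if w \<in> A then 0 else of_bool (w \<in> L) + avg (green A L) w)"
proof -
  have "green A L w = flow A L 0 w + (\<Sum>n. flow A L (Suc n) w)"
    unfolding green_def by (subst suminf_offset [where i = 1]) auto
  then show ?thesis
    by (auto simp: green_def [abs_def] avg_suminf)
qed

text \<open>The visits before time \<open>Suc m\<close> consist of a visit at time 0 and the average
  of the visits before time \<open>m\<close>, so induction on the horizon keeps them below any
  supersolution. The base case is the nonnegativity built into \<open>ennreal\<close>.\<close>

lemma green_le:
  assumes r: "\<And>w. w \<notin> A \<Longrightarrow> of_bool (w \<in> L) + avg r w \<le> r w"
  shows "green A L w \<le> r w"
proof -
  have "(\<Sum>n<m. flow A L n w) \<le> r w" for m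
  proof (induction m arbitrary: w)
    case (Suc m)
    have "(\<Sum>n<Suc m. flow A L n w) = flow A L 0 w + (\<Sum>n<m. flow A L (Suc n) w)"
      by (rule sum.lessThan_Suc_shift)
    also have "\<dots> \<le> r w"
    proof (cases "w \<in> A")
      case False
      have "(\<Sum>n<m. avg (flow A L n) w) = avg (\<lambda>w. \<Sum>n<m. flow A L n w) w"
        by (induction m) (auto simp: avg_add)
      also have "\<dots> \<le> avg r w" by (intro avg_mono Suc)
      finally show ?thesis using False r [OF False] by (auto intro: order_trans add_left_mono)
    qed simp
    finally show ?case .
  qed simp
  then show ?thesis unfolding green_def by (intro suminf_le_const) auto
qed

text \<open>An enumeration of an infinite \<open>A\<close> turns both sides into one series. It
  moves \<open>Hbar_N\<close> to a counting integral, which commutes with \<open>avg\<close> and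
  with \<open>suminf\<close>.\<close>

lemma infsum_eq_nn_integral_count_space:
  fixes f :: "'a \<Rightarrow> ennreal"
  assumes "countable A"
  shows "infsum f A = (\<integral>\<^sup>+x. f x \<partial>count_space A)"
proof (cases "finite A")
  case True
  then show ?thesis by (simp add: nn_integral_count_space_finite)
next
  case False
  have bij: "bij_betw (from_nat_into A) UNIV A"
    using bij_betw_from_nat_into [OF assms False] .
  have "((\<lambda>n. f (from_nat_into A n)) has_sum infsum (\<lambda>n. f (from_nat_into A n)) UNIV) UNIV"
    by (intro has_sum_infsum nonneg_summable_on_complete) simp
  then have "(\<lambda>n. f (from_nat_into A n)) sums infsum (\<lambda>n. f (from_nat_into A n)) UNIV"
    by (rule has_sum_imp_sums)
  then have "(\<Sum>n. f (from_nat_into A n)) = infsum (\<lambda>n. f (from_nat_into A n)) UNIV"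
    by (rule sums_unique [symmetric])
  then show ?thesis
    using nn_integral_bij_count_space [OF bij, of f] infsum_reindex_bij_betw [OF bij, of f]
    by (simp add: nn_integral_count_space_nat)
qed

section \<open>The walk, its first hitting times and time reversal\<close>

lemma walk_0 [simp]: "walk z \<omega> 0 = z"
  by (simp add: walk_def)

lemma walk_Suc: "walk z \<omega> (Suc n) = walk z \<omega> n + \<omega> !! n"
  by (simp add: walk_def prod_eq_iff)

lemma walk_SCons: "walk z (s ## \<omega>) (Suc n) = walk (z + s) \<omega> n"
  by (induction n) (simp_all add: walk_Suc add.assoc)

lemma measurable_walk [measurable]: "(\<lambda>\<omega>. walk z \<omega> n) \<in> measurable srw_space (count_space UNIV)"
proof (induction n)
  case (Suc n)
  have [measurable]: "(\<lambda>\<omega>. \<omega> !! n) \<in> measurable srw_space (count_space UNIV)"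
    unfolding srw_space_def by measurable
  note [measurable] = Suc
  have "(\<lambda>\<omega>. (\<lambda>u. u + \<omega> !! n) (walk z \<omega> n)) \<in> measurable srw_space (count_space UNIV)"
    by (rule measurable_compose_countable) measurable
  then show ?case by (simp add: walk_Suc)
qed simp

text \<open>The condition \<open>x \<in> A\<close> is left to the users, so that the first-step
  recursion holds for every \<open>x\<close>.\<close>

definition first_hit :: "pt set \<Rightarrow> pt \<Rightarrow> nat \<Rightarrow> pt \<Rightarrow> ennreal" where
  "first_hit A x n z = emeasure srw_space
     {\<omega> \<in> space srw_space. walk z \<omega> n = x \<and> (\<forall>m<n. walk z \<omega> m \<notin> A)}"

lemma space_srw_space [simp]: "space srw_space = UNIV"
  by (simp add: srw_space_def space_stream_space)

lemma first_hit_sets [measurable]: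
  "{\<omega>. walk z \<omega> n = x \<and> (\<forall>m<n. walk z \<omega> m \<notin> A)} \<in> sets srw_space"
proof -
  have "{\<omega> \<in> space srw_space. walk z \<omega> n = x \<and> (\<forall>m<n. walk z \<omega> m \<notin> A)} \<in> sets srw_space"
    by measurable
  then show ?thesis by simp
qed

lemma first_hit_0: "first_hit A x 0 z = of_bool (z = x)"
proof -
  interpret prob_space srw_space
    unfolding srw_space_def by (intro prob_space.prob_space_stream_space prob_space_measure_pmf)
  show ?thesis using emeasure_space_1 by (auto simp: first_hit_def)
qed

lemma first_hit_Suc:
  "first_hit A x (Suc n) z = (if z \<in> A then 0 else avg (first_hit A x n) z)"
proof -
  have *: "{\<omega>. (s ## \<omega>) \<in> {\<omega>. walk z \<omega> (Suc n) = x \<and> (\<forall>m<Suc n. walk z \<omega> m \<notin> A)}}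
     = (if z \<in> A then {} else {\<omega>. walk (z + s) \<omega> n = x \<and> (\<forall>m<n. walk (z + s) \<omega> m \<notin> A)})" for s
    by (auto simp: walk_SCons All_less_Suc2)
  have "first_hit A x (Suc n) z = (\<integral>\<^sup>+s. emeasure srw_space {\<omega> \<in> space srw_space.
      (s ## \<omega>) \<in> {\<omega>. walk z \<omega> (Suc n) = x \<and> (\<forall>m<Suc n. walk z \<omega> m \<notin> A)}} \<partial>measure_pmf srw_steps)"
    unfolding first_hit_def
    using prob_space.emeasure_stream_space [OF prob_space_measure_pmf,
        where X = "{\<omega>. walk z \<omega> (Suc n) = x \<and> (\<forall>m<Suc n. walk z \<omega> m \<notin> A)}"]
      first_hit_sets[of z "Suc n" x A]
    by (simp add: srw_space_def space_stream_space)
  also have "\<dots> = (\<integral>\<^sup>+s. (if z \<in> A then 0 else first_hit A x n (z + s)) \<partial>measure_pmf srw_steps)"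
    using * by (intro nn_integral_cong) (auto simp: first_hit_def)
  finally show ?thesis by (simp add: nn_integral_srw_steps)
qed

text \<open>The outer average is over the last step into \<open>x\<close>; before it the walk stays
  off \<open>A\<close> at times 0 to \<open>n\<close>, which is exactly what \<open>flow\<close>
  records. The induction peels the first step off both sides.\<close>

lemma first_hit_eq_flow: "first_hit A x (Suc n) z = avg (flow A {z} n) x"
proof (induction n arbitrary: z)
  case 0
  have "first_hit A x (Suc 0) z = (if z \<in> A then 0 else avg (\<lambda>u. of_bool (u = x)) z)"
    by (simp add: first_hit_Suc first_hit_0 [abs_def])
  moreover have "flow A {z} 0 = (\<lambda>w. if z \<in> A then 0 else of_bool (w = z))"
    by (intro ext flow_singleton_0)
  ultimately show ?case
    by (simp add: avg_of_bool_eq_commute [of x z])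
next
  case (Suc n)
  have "first_hit A x (Suc (Suc n)) z = (if z \<in> A then 0 else avg (\<lambda>z'. avg (flow A {z'} n) x) z)"
    by (subst first_hit_Suc) (simp add: Suc [abs_def])
  also have "\<dots> = (if z \<in> A then 0 else avg (\<lambda>w. avg (\<lambda>z'. flow A {z'} n w) z) x)"
    by (simp only: avg_commute [of "\<lambda>z' w. flow A {z'} n w" x z])
  also have "\<dots> = avg (\<lambda>w. flow A {z} (Suc n) w) x"
    by (simp only: flow_first_step) simp
  finally show ?case .
qed

lemma hit_prob_eq_suminf:
  assumes "x \<in> A"
  shows "hit_prob z A x = (\<Sum>n. first_hit A x n z)"
proof -
  let ?E = "\<lambda>n. {\<omega>. walk z \<omega> n = x \<and> (\<forall>m<n. walk z \<omega> m \<notin> A)}"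
  have "disjoint_family ?E"
    unfolding disjoint_family_on_def using assms
    by (auto simp: disjoint_iff) (metis linorder_neqE_nat)
  then have "(\<Sum>n. emeasure srw_space (?E n)) = emeasure srw_space (\<Union>n. ?E n)"
    by (intro suminf_emeasure) auto
  moreover have "(\<Union>n. ?E n) = {\<omega>. \<exists>n. walk z \<omega> n \<in> A \<and> walk z \<omega> n = x \<and> (\<forall>m<n. walk z \<omega> m \<notin> A)}"
    using assms by auto
  ultimately show ?thesis by (simp add: hit_prob_def first_hit_def)
qed

lemma hit_prob_eq_green:
  assumes "x \<in> A" "z \<notin> A"
  shows "hit_prob z A x = avg (green A {z}) x"
proof -
  have "hit_prob z A x = first_hit A x 0 z + (\<Sum>n. first_hit A x (Suc n) z)"
    unfolding hit_prob_eq_suminf [OF assms(1)]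
    by (subst suminf_offset [where i = 1]) auto
  \<comment> \<open>A start off \<open>A\<close> differs from \<open>x\<close>, so there is always a
    last step into \<open>x\<close>.\<close>
  also have "first_hit A x 0 z = 0" using assms by (auto simp: first_hit_0)
  finally show ?thesis
    by (simp add: first_hit_eq_flow green_def [abs_def] avg_suminf)
qed

lemma green_eq_nn_integral: "green A L w = (\<integral>\<^sup>+z. green A {z} w \<partial>count_space L)"
proof -
  have "green A L w = (\<Sum>n. \<integral>\<^sup>+z. flow A {z} n w \<partial>count_space L)"
    unfolding green_def by (rule suminf_cong) (rule flow_eq_nn_integral)
  then show ?thesis
    by (simp add: nn_integral_suminf green_def)
qed

lemma Hbar_N_eq_green:
  assumes "x \<in> B" "N > 0"
  shows "Hbar_N B N x = avg (green (B \<union> line 0) (line (int N) - B)) x"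
proof -
  have "Hbar_N B N x = (\<integral>\<^sup>+z. hit_prob z (B \<union> line 0) x \<partial>count_space (line (int N) - B))"
    unfolding Hbar_N_def by (rule infsum_eq_nn_integral_count_space) auto
  also have "\<dots> = (\<integral>\<^sup>+z. avg (green (B \<union> line 0) {z}) x \<partial>count_space (line (int N) - B))"
    using assms by (intro nn_integral_cong hit_prob_eq_green) (auto simp: line_def)
  also have "\<dots> = avg (green (B \<union> line 0) (line (int N) - B)) x"
    unfolding avg_nn_integral [symmetric] by (simp only: green_eq_nn_integral [symmetric])
  finally show ?thesis .
qed

section \<open>Monotonicity in N and an upper bound by the height\<close>

lemma avg_ennreal:
  assumes "\<And>w. 0 \<le> f w"
  shows "avg (\<lambda>w. ennreal (f w)) w =
    ennreal ((f (w + (1,0)) + f (w + (-1,0)) + f (w + (0,1)) + f (w + (0,-1))) / 4)"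
proof -
  let ?s = "f (w + (1,0)) + f (w + (-1,0)) + f (w + (0,1)) + f (w + (0,-1))"
  have "avg (\<lambda>w. ennreal (f w)) w = ennreal ?s / ennreal 4"
    using assms by (simp add: avg_def)
  also have "\<dots> = ennreal (?s / 4)"
    using assms by (intro divide_ennreal) (auto intro!: add_nonneg_nonneg)
  finally show ?thesis .
qed

lemma of_bool_eq_ennreal: "of_bool b = ennreal (of_bool b)"
  by (cases b) auto

text \<open>Adding a ramp that vanishes up to height \<open>N\<close> to the occupation function of
  \<open>line N\<close> gives a supersolution for the source on \<open>line (Suc N)\<close>.
  Minimality of \<open>green\<close> then yields the comparison wherever the ramp is zero.\<close>

lemma green_line_Suc_le:
  assumes "B \<subseteq> A" and w: "snd w \<le> int N"
  shows "green A (line (int (Suc N)) - B) w \<le> green A (line (int N) - B) w"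
proof -
  \<comment> \<open>The rise of 4 between heights \<open>N\<close> and \<open>N + 1\<close> makes
    the ramp fall short of its average by 1 at height \<open>N\<close> and exceed it by 1 at height
    \<open>N + 1\<close>, which moves the unit source up one line.\<close>
  define s' :: "pt \<Rightarrow> real" where "s' u = 4 * min 1 (max 0 (real_of_int (snd u) - N))" for u
  define s :: "pt \<Rightarrow> ennreal" where "s u = ennreal (s' u)" for u
  have s'_nonneg: "0 \<le> s' u" for u by (simp add: s'_def)
  define r where "r u = green A (line (int N) - B) u + s u" for u
  have s: "of_bool (snd u = int N + 1) + avg s u = of_bool (snd u = int N) + s u" for u
  proof -
    consider "snd u < int N" | "snd u = int N" | "snd u = int N + 1" | "snd u > int N + 1"
      by linarith
    then have "of_bool (snd u = int N + 1) + (s' (u + (1,0)) + s' (u + (-1,0)) + s' (u + (0,1)) + s' (u + (0,-1))) / 4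
        = of_bool (snd u = int N) + s' u"
      by cases (auto simp: s'_def)
    moreover have "avg s u = ennreal ((s' (u + (1,0)) + s' (u + (-1,0)) + s' (u + (0,1)) + s' (u + (0,-1))) / 4)"
      unfolding s_def by (rule avg_ennreal) (simp add: s'_def)
    ultimately show ?thesis
      by (simp add: s_def of_bool_eq_ennreal s'_nonneg flip: ennreal_plus)
  qed
  have "green A (line (int (Suc N)) - B) w \<le> r w"
  proof (rule green_le)
    fix u assume u: "u \<notin> A"
    have "of_bool (u \<in> line (int (Suc N)) - B) + avg r u
        = avg (green A (line (int N) - B)) u + (of_bool (snd u = int N + 1) + avg s u)"
      using u \<open>B \<subseteq> A\<close> unfolding r_def by (auto simp: avg_add line_def add_ac)
    also have "\<dots> = r u"
      unfolding s r_def using u \<open>B \<subseteq> A\<close> green_unfold [of A "line (int N) - B" u]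
      by (auto simp: line_def add_ac)
    finally show "of_bool (u \<in> line (int (Suc N)) - B) + avg r u \<le> r u" by simp
  qed
  also have "r w = green A (line (int N) - B) w"
    using w by (simp add: r_def s_def s'_def)
  finally show ?thesis .
qed

text \<open>The capped height with slope 4 exceeds its average by exactly 1 at height
  \<open>N\<close>, and its other kink, at height 0, lies inside \<open>A\<close>; so it is a
  supersolution. Finiteness of \<open>green\<close> follows, which permits real subtraction
  later.\<close>

lemma green_line_le:
  assumes "B \<subseteq> A" "line 0 \<subseteq> A" "N > 0"
  shows "green A (line (int N) - B) w \<le> ennreal (4 * min N (max 0 (real_of_int (snd w))))"
proof -
  define r where "r w = 4 * min (real N) (max 0 (real_of_int (snd w)))" for w :: pt
  have r_nonneg: "0 \<le> r w" for w by (simp add: r_def)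
  have "green A (line (int N) - B) w \<le> ennreal (r w)"
  proof (rule green_le)
    fix u assume u: "u \<notin> A"
    then have "snd u \<noteq> 0" using assms by (auto simp: line_def)
    then consider "snd u < 0" | "0 < snd u" "snd u < int N" | "snd u = int N" | "snd u > int N"
      by linarith
    then have "of_bool (u \<in> line (int N) - B) + (r (u + (1,0)) + r (u + (-1,0)) + r (u + (0,1)) + r (u + (0,-1))) / 4
        \<le> r u"
      using u assms by cases (auto simp: r_def line_def field_simps)
    moreover have "avg (\<lambda>w. ennreal (r w)) u = ennreal ((r (u + (1,0)) + r (u + (-1,0)) + r (u + (0,1)) + r (u + (0,-1))) / 4)"
      by (rule avg_ennreal) (rule r_nonneg)
    ultimately show "of_bool (u \<in> line (int N) - B) + avg (\<lambda>w. ennreal (r w)) u \<le> ennreal (r u)"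
      by (simp add: of_bool_eq_ennreal r_nonneg flip: ennreal_plus)
  qed
  then show ?thesis by (simp add: r_def)
qed

section \<open>A strictly superharmonic weight of sublinear growth on the axis\<close>

text \<open>
  The double sum is concave in the height $y$, with second difference $-y^{\beta-2}$. By concavity of
  $t \mapsto t^{\beta/2}$ the four-neighbour Laplacian of $(x^2+y^2)^{\beta/2}$ is at most
  $2\beta(x^2+y^2)^{\beta/2-1} \le 2\beta y^{\beta-2}$, which twice the former outweighs as $\beta < 1$.
\<close>

definition superharmonic_weight :: "real \<Rightarrow> pt \<Rightarrow> real" where
  "superharmonic_weight \<beta> w = 2 * (\<Sum>j<nat (snd w). \<Sum>k. real (k + Suc j) powr (\<beta> - 2))
     + (real_of_int (fst w) ^ 2 + real_of_int (snd w) ^ 2) powr (\<beta> / 2)"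

lemma power2_powr_half: "(a ^ 2) powr (b / 2) = \<bar>a\<bar> powr b" for a b :: real
proof -
  have "a ^ 2 = \<bar>a\<bar> powr 2" by simp
  then show ?thesis by (simp only: powr_powr) simp
qed

context
  fixes \<beta> :: real
  assumes \<beta>: "0 < \<beta>" "\<beta> < 1"
begin

lemma summable_tail_powr: "summable (\<lambda>k. real (k + Suc j) powr (\<beta> - 2))"
  using \<beta> summable_real_powr_iff [of "\<beta> - 2"]
  by (subst summable_iff_shift) auto

lemma tail_powr_nonneg: "0 \<le> (\<Sum>k. real (k + Suc j) powr (\<beta> - 2))"
  by (intro suminf_nonneg summable_tail_powr) auto

lemma tail_powr_step:
  "(\<Sum>k. real (k + Suc j) powr (\<beta> - 2)) =
    real (Suc j) powr (\<beta> - 2) + (\<Sum>k. real (k + Suc (Suc j)) powr (\<beta> - 2))"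
  using suminf_split_head [OF summable_tail_powr [of j]] by (simp add: add_ac)

lemma tail_powr_tendsto_0: "(\<lambda>j. \<Sum>k. real (k + Suc j) powr (\<beta> - 2)) \<longlonglongrightarrow> 0"
proof -
  have "summable (\<lambda>k. real k powr (\<beta> - 2))"
    using \<beta> summable_real_powr_iff [of "\<beta> - 2"] by auto
  from LIMSEQ_Suc [OF suminf_exist_split2 [OF this]] show ?thesis
    by simp
qed

text \<open>Concavity in tangent-line form: Young's inequality for \<open>s / t\<close> and 1,
  scaled by \<open>t powr (\<beta> / 2)\<close>.\<close>

lemma powr_tangent_le:
  assumes "0 < t" "0 \<le> s"
  shows "s powr (\<beta> / 2) \<le> t powr (\<beta> / 2) + \<beta> / 2 * t powr (\<beta> / 2 - 1) * (s - t)"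
proof -
  have "(s / t) powr (\<beta> / 2) \<le> \<beta> / 2 * (s / t) + (1 - \<beta> / 2)"
  proof (cases "s = 0")
    case False
    then show ?thesis
      using Youngs_inequality_0 [of "\<beta> / 2" "1 - \<beta> / 2" "s / t" 1] assms \<beta> by simp
  qed (use \<beta> in simp)
  then have "t powr (\<beta> / 2) * (s / t) powr (\<beta> / 2) \<le> t powr (\<beta> / 2) * (\<beta> / 2 * (s / t) + (1 - \<beta> / 2))"
    by (intro mult_left_mono) auto
  also have "\<dots> = t powr (\<beta> / 2) + \<beta> / 2 * t powr (\<beta> / 2 - 1) * (s - t)"
  proof -
    define p where "p = t powr (\<beta> / 2 - 1)"
    have "t powr (\<beta> / 2) = t * p"
      using assms by (simp add: p_def powr_diff)
    then show ?thesis using assms by (simp flip: p_def) (simp add: field_simps)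
  qed
  finally show ?thesis using assms by (simp add: powr_divide)
qed

lemma superharmonic_weight_strict:
  assumes "0 < snd w"
  shows "superharmonic_weight \<beta> (w + (1,0)) + superharmonic_weight \<beta> (w + (-1,0))
    + superharmonic_weight \<beta> (w + (0,1)) + superharmonic_weight \<beta> (w + (0,-1))
    < 4 * superharmonic_weight \<beta> w"
proof -
  obtain x m where w: "w = (x, int (Suc m))"
    using assms by (cases w) (metis snd_conv zero_less_imp_eq_int not0_implies_Suc less_irrefl of_nat_0)
  define y where "y = real (Suc m)"
  define T where "T j = (\<Sum>k. real (k + Suc j) powr (\<beta> - 2))" for j
  define f where "f n = (\<Sum>j<n. T j)" for n
  define t where "t = real_of_int x ^ 2 + y ^ 2"
  have y: "1 \<le> y" by (simp add: y_def)
  then have t: "y ^ 2 \<le> t" "0 < t" by (auto simp: t_def add_nonneg_pos)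
  define c where "c = \<beta> / 2 * t powr (\<beta> / 2 - 1)"
  have tangent: "s powr (\<beta> / 2) \<le> t powr (\<beta> / 2) + c * (s - t)" if "0 \<le> s" for s
    using powr_tangent_le [OF t(2) that] by (simp add: c_def)
  define g where "g a b = ((real_of_int x + a) ^ 2 + (y + b) ^ 2) powr (\<beta> / 2)" for a b
  \<comment> \<open>The tangent is taken at the squared distance \<open>t\<close> of the centre.
    Over the four neighbours the linear terms cancel, and each step has squared length 1, which
    leaves \<open>4 * c\<close>.\<close>
  have sum_g: "g 1 0 + g (-1) 0 + g 0 1 + g 0 (-1) \<le> 4 * t powr (\<beta> / 2) + 4 * c"
  proof -
    have "g a b \<le> t powr (\<beta> / 2) + c * (2 * real_of_int x * a + 2 * y * b + a ^ 2 + b ^ 2)" for a b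
      using tangent [of "(real_of_int x + a) ^ 2 + (y + b) ^ 2", OF add_nonneg_nonneg [OF zero_le_power2 zero_le_power2]]
      by (simp add: g_def t_def power2_eq_square algebra_simps)
    from this [of 1 0] this [of "-1" 0] this [of 0 1] this [of 0 "-1"] show ?thesis
      by (simp add: algebra_simps)
  qed
  have "t powr (\<beta> / 2 - 1) \<le> (y ^ 2) powr (\<beta> / 2 - 1)"
    using t y \<beta> by (intro powr_mono2') auto
  moreover have "(y ^ 2) powr (\<beta> / 2 - 1) = y powr (\<beta> - 2)"
    using power2_powr_half [of y "\<beta> - 2"] y by (simp add: diff_divide_distrib)
  ultimately have "c \<le> \<beta> / 2 * y powr (\<beta> - 2)"
    using \<beta> unfolding c_def by (intro mult_left_mono) auto
  \<comment> \<open>Strictness comes from \<beta> < 1; the right-hand side is what the doubled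
    concave part \<open>f\<close> loses across the two vertical neighbours.\<close>
  then have c_bound: "4 * c < 2 * y powr (\<beta> - 2)"
  proof -
    have "\<beta> * y powr (\<beta> - 2) < 1 * y powr (\<beta> - 2)"
      using \<beta> y by (intro mult_strict_right_mono) auto
    with \<open>c \<le> \<beta> / 2 * y powr (\<beta> - 2)\<close> show ?thesis by simp
  qed
  have f_step: "f (Suc (Suc m)) + f m = 2 * f (Suc m) - y powr (\<beta> - 2)"
    using tail_powr_step [of m] by (simp add: f_def T_def y_def)
  have eq: "superharmonic_weight \<beta> (x + a, int n) = 2 * f n + g (real_of_int a) (real n - y)" for a n
    by (simp add: superharmonic_weight_def f_def T_def g_def)
  have "superharmonic_weight \<beta> (w + (1,0)) = 2 * f (Suc m) + g 1 0"
    "superharmonic_weight \<beta> (w + (-1,0)) = 2 * f (Suc m) + g (-1) 0"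
    "superharmonic_weight \<beta> (w + (0,1)) = 2 * f (Suc (Suc m)) + g 0 1"
    "superharmonic_weight \<beta> (w + (0,-1)) = 2 * f m + g 0 (-1)"
    "superharmonic_weight \<beta> w = 2 * f (Suc m) + g 0 0"
    using eq [of 1 "Suc m"] eq [of "-1" "Suc m"] eq [of 0 "Suc (Suc m)"] eq [of 0 m] eq [of 0 "Suc m"]
    by (simp_all add: w y_def add_ac)
  moreover have "g 0 0 = t powr (\<beta> / 2)"
    by (simp add: g_def t_def)
  ultimately show ?thesis
    using sum_g c_bound f_step by linarith
qed

text \<open>The horizontal bound will dominate the heights of all but finitely many points of
  \<open>B\<close>; with the vertical one it also makes sublevel sets bounded.\<close>

lemma superharmonic_weight_ge: "\<bar>real_of_int (fst w)\<bar> powr \<beta> \<le> superharmonic_weight \<beta> w"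
  and superharmonic_weight_ge': "\<bar>real_of_int (snd w)\<bar> powr \<beta> \<le> superharmonic_weight \<beta> w"
proof -
  have *: "\<bar>a\<bar> powr \<beta> \<le> (a ^ 2 + b ^ 2) powr (\<beta> / 2)" for a b :: real
  proof -
    have "\<bar>a\<bar> powr \<beta> = (a ^ 2) powr (\<beta> / 2)"
      by (rule power2_powr_half [symmetric])
    also have "\<dots> \<le> (a ^ 2 + b ^ 2) powr (\<beta> / 2)"
      using \<beta> by (intro powr_mono2) auto
    finally show ?thesis .
  qed
  have **: "(real_of_int (fst w) ^ 2 + real_of_int (snd w) ^ 2) powr (\<beta> / 2) \<le> superharmonic_weight \<beta> w"
    unfolding superharmonic_weight_def
    using sum_nonneg [of "{..<nat (snd w)}", OF tail_powr_nonneg] by simp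
  show "\<bar>real_of_int (fst w)\<bar> powr \<beta> \<le> superharmonic_weight \<beta> w"
    using * ** by (rule order_trans)
  show "\<bar>real_of_int (snd w)\<bar> powr \<beta> \<le> superharmonic_weight \<beta> w"
    using *[of "snd w" "fst w"] ** by (simp add: add.commute)
qed

lemma finite_superharmonic_weight_less: "finite {w. superharmonic_weight \<beta> w < c}"
proof -
  define K where "K = \<lceil>max c 0 powr (1 / \<beta>)\<rceil>"
  have *: "\<bar>a\<bar> \<le> K" if "\<bar>real_of_int a\<bar> powr \<beta> < c" for a :: int
  proof -
    have "(\<bar>real_of_int a\<bar> powr \<beta>) powr (1 / \<beta>) \<le> max c 0 powr (1 / \<beta>)"
      using that \<beta> by (intro powr_mono2) auto
    then show ?thesis using \<beta> by (simp add: K_def powr_powr) linarith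
  qed
  have "{w. superharmonic_weight \<beta> w < c} \<subseteq> {-K..K} \<times> {-K..K}"
  proof
    fix w assume "w \<in> {w. superharmonic_weight \<beta> w < c}"
    then have "\<bar>fst w\<bar> \<le> K" "\<bar>snd w\<bar> \<le> K"
      using superharmonic_weight_ge [of w] superharmonic_weight_ge' [of w] by (auto intro!: *)
    then show "w \<in> {-K..K} \<times> {-K..K}" by (cases w) auto
  qed
  then show ?thesis by (rule finite_subset) auto
qed

text \<open>The tails \<open>T j\<close> tend to 0, so their sum up to \<open>R\<close> is o(R), and
  so is \<open>R powr \<beta>\<close> because \<beta> < 1.\<close>

lemma superharmonic_weight_sublinear:
  "\<exists>R>0. superharmonic_weight \<beta> (0, int R) + C < R"
proof -
  define T where "T j = (\<Sum>k. real (k + Suc j) powr (\<beta> - 2))" for j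
  \<comment> \<open>With 1/8 the doubled sum beyond \<open>J\<close> costs at most
    \<open>R / 4\<close>; everything else is kept below \<open>R / 2\<close>.\<close>
  obtain J where J: "T j < 1 / 8" if "J \<le> j" for j
    using order_tendstoD(2) [OF tail_powr_tendsto_0, of "1 / 8"]
    by (auto simp: eventually_sequentially T_def)
  have sum: "(\<Sum>j<R. T j) \<le> (\<Sum>j<J. T j) + R / 8" if "J \<le> R" for R
    using that
  proof (induction R rule: dec_induct)
    case (step n)
    then show ?case using J [of n] by (simp add: add_divide_distrib)
  qed simp
  have "eventually (\<lambda>R. 2 * (\<Sum>j<J. T j) + C + real R powr \<beta> < real R / 2) at_top"
  proof -
    have "eventually (\<lambda>R::nat. D + real R powr \<beta> < real R / 2) at_top" for D
      using \<beta> by real_asymp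
    then show ?thesis .
  qed
  then have "eventually (\<lambda>R. 2 * (\<Sum>j<J. T j) + C + real R powr \<beta> < real R / 2 \<and> J \<le> R \<and> 0 < R) at_top"
    by (intro eventually_conj eventually_ge_at_top eventually_gt_at_top)
  then obtain R where R: "2 * (\<Sum>j<J. T j) + C + real R powr \<beta> < real R / 2" "J \<le> R" "0 < R"
    by (metis (mono_tags, lifting) eventually_sequentially order_refl)
  have "superharmonic_weight \<beta> (0, int R) = 2 * (\<Sum>j<R. T j) + real R powr \<beta>"
    using R by (simp add: superharmonic_weight_def T_def power2_powr_half)
  then show ?thesis using R sum [OF R(2)] by (intro exI [of _ R]) auto
qed

end

section \<open>The lower bound by the minimum principle\<close>

lemma green_line_ge:
  fixes \<phi> :: "pt \<Rightarrow> real"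
  assumes "B \<subseteq> A" "line 0 \<subseteq> A" "N > 0"
    and bound: "\<And>w. w \<in> A \<Longrightarrow> real_of_int (snd w) \<le> \<phi> w"
    and nonneg: "\<And>w. 0 \<le> \<phi> w"
    and strict: "\<And>w. 0 < snd w \<Longrightarrow> \<phi> (w + (1,0)) + \<phi> (w + (-1,0)) + \<phi> (w + (0,1)) + \<phi> (w + (0,-1)) < 4 * \<phi> w"
    and fin: "finite {w. \<phi> w < real N}"
  shows "ennreal (4 * (min (real N) (real_of_int (snd w)) - \<phi> w)) \<le> green A (line (int N) - B) w"
proof -
  define g where "g w = enn2real (green A (line (int N) - B) w)" for w
  have green_eq: "green A (line (int N) - B) w = ennreal (g w)" for w
    using green_line_le [OF assms(1-3), of w] unfolding g_def
    by (metis ennreal_enn2real ennreal_less_top le_less_trans)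
  have g0: "0 \<le> g w" for w by (simp add: g_def)
  have g_eq: "g w = of_bool (snd w = int N) + (g (w + (1,0)) + g (w + (-1,0)) + g (w + (0,1)) + g (w + (0,-1))) / 4"
    if "w \<notin> A" for w
  proof -
    have "ennreal (g w) = of_bool (w \<in> line (int N) - B) + avg (green A (line (int N) - B)) w"
      using that green_unfold [of A _ w] by (simp flip: green_eq)
    also have "avg (green A (line (int N) - B)) w = avg (\<lambda>w. ennreal (g w)) w"
      by (simp add: green_eq [abs_def])
    also have "of_bool (w \<in> line (int N) - B) = (of_bool (snd w = int N) :: ennreal)"
      using that assms(1) by (auto simp: line_def)
    finally show ?thesis
      by (simp add: avg_ennreal g0 of_bool_eq_ennreal flip: ennreal_plus)
  qed
  define h where "h w = g w - 4 * (min (real N) (real_of_int (snd w)) - \<phi> w)" for w :: pt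
  \<comment> \<open>Only on \<open>S\<close> does the claimed bound say more than nonnegativity of
    \<open>g\<close>. \<open>S\<close> is finite, so a minimum of \<open>h\<close> over it is
    attained.\<close>
  define S :: "pt set" where "S = {w. min (real N) (real_of_int (snd w)) - \<phi> w > 0}"
  have "S \<subseteq> {w. \<phi> w < real N}" by (auto simp: S_def)
  then have "finite S" using fin by (rule finite_subset)
  have outside: "0 \<le> h w" if "w \<notin> S" for w
    using that g0 [of w] by (simp add: h_def S_def min_def split: if_splits)
  have "0 \<le> h w" for w
  proof (rule ccontr)
    assume neg: "\<not> 0 \<le> h w"
    then have "w \<in> S" using outside by blast
    then have "S \<noteq> {}" by blast
    define z where "z = arg_min_on h S"
    have z: "z \<in> S"
      unfolding z_def using \<open>finite S\<close> \<open>S \<noteq> {}\<close> by (rule arg_min_if_finite)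
    have min: "h z \<le> h u" if "u \<in> S" for u
      unfolding z_def using \<open>finite S\<close> \<open>S \<noteq> {}\<close> that by (rule arg_min_least)
    \<comment> \<open>\<open>h\<close> is negative at \<open>w\<close> and nonnegative off
      \<open>S\<close>, so the minimum over \<open>S\<close> is global.\<close>
    have le: "h z \<le> h u" for u
      using min [of u] min [OF \<open>w \<in> S\<close>] outside [of u] neg by linarith
    have "z \<notin> A" and "0 < snd z" using z bound [of z] nonneg [of z] by (auto simp: S_def)
    note z_eqs = g_eq [OF \<open>z \<notin> A\<close>] strict [OF \<open>0 < snd z\<close>]
    define m where "m u = min (real N) (real_of_int (snd u))" for u :: pt
    \<comment> \<open>The capped height has a kink only at height \<open>N\<close>. Multiplied by 4
      it cancels the unit source of \<open>g\<close>, so \<open>h\<close> inherits strict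
      superharmonicity from \<phi>, which is impossible at a global minimum.\<close>
    have "4 * m z = m (z + (1,0)) + m (z + (-1,0)) + m (z + (0,1)) + m (z + (0,-1)) + of_bool (snd z = int N)"
      by (cases "snd z" "int N" rule: linorder_cases) (auto simp: m_def)
    then have "h (z + (1,0)) + h (z + (-1,0)) + h (z + (0,1)) + h (z + (0,-1)) < 4 * h z"
      using z_eqs unfolding h_def m_def [symmetric] by argo
    then show False
      using le [of "z + (1,0)"] le [of "z + (-1,0)"] le [of "z + (0,1)"] le [of "z + (0,-1)"] by linarith
  qed
  from this [of w] show ?thesis unfolding green_eq by (intro ennreal_leI) (simp add: h_def)
qed

text \<open>The value of \<open>lim\<close> is known only once convergence is proved. Monotonicity
  from \<open>M\<close> on supplies it, and the uniform lower bound passes to the limit.\<close>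

lemma Hbar_pos:
  assumes "x \<in> B" "0 < c" "eventually (\<lambda>N. c \<le> Hbar_N B N x) sequentially"
  shows "0 < Hbar B x"
proof -
  \<comment> \<open>All neighbours of \<open>x\<close> have height at most \<open>M\<close>, and
    \<open>Suc\<close> makes every index from \<open>M\<close> on positive.\<close>
  define M where "M = Suc (nat (snd x + 1))"
  have dec: "Hbar_N B (Suc N) x \<le> Hbar_N B N x" if "M \<le> N" for N
  proof -
    have "avg (green (B \<union> line 0) (line (int (Suc N)) - B)) x \<le> avg (green (B \<union> line 0) (line (int N) - B)) x"
      unfolding avg_def using that
      by (intro divide_right_mono_ennreal add_mono green_line_Suc_le) (auto simp: M_def)
    then show ?thesis using assms(1) that by (simp add: Hbar_N_eq_green M_def)
  qed
  have "decseq (\<lambda>N. Hbar_N B (N + M) x)"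
    by (intro decseq_SucI) (use dec in simp)
  then have "(\<lambda>N. Hbar_N B (N + M) x) \<longlonglongrightarrow> (INF N. Hbar_N B (N + M) x)"
    by (rule LIMSEQ_INF)
  then have lim: "(\<lambda>N. Hbar_N B N x) \<longlonglongrightarrow> (INF N. Hbar_N B (N + M) x)"
    by (rule LIMSEQ_offset)
  then have "c \<le> Hbar B x"
    unfolding Hbar_def limI [OF lim] using assms(3) by (rule tendsto_lowerbound) simp
  with assms(2) show ?thesis by simp
qed

section \<open>Propagation of positivity to a point of B\<close>

theorem theorem2:
  fixes B :: "(int \<times> int) set" and \<alpha> :: real
  assumes "B \<subseteq> HH" and "B \<noteq> {}" and "\<alpha> > 1"
    and "finite (B - {x \<in> HH. real_of_int (snd x) \<le> \<bar>real_of_int (fst x)\<bar> powr (1 / \<alpha>)})"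
  shows "\<exists>x\<in>B. Hbar B x > 0"
proof (rule ccontr)
  assume none: "\<not> (\<exists>x\<in>B. Hbar B x > 0)"
  define A where "A = B \<union> line 0"
  define \<beta> where "\<beta> = 1 / \<alpha>"
  have \<beta>: "0 < \<beta>" "\<beta> < 1" using assms(3) by (auto simp: \<beta>_def)
  define F where "F = B - {x \<in> HH. real_of_int (snd x) \<le> \<bar>real_of_int (fst x)\<bar> powr \<beta>}"
  have "finite F" using assms(4) by (simp add: F_def \<beta>_def)
  \<comment> \<open>\<open>C\<close> absorbs the heights of the finitely many exceptional points;
    elsewhere on \<open>A\<close> the weight suffices.\<close>
  define C where "C = (\<Sum>x\<in>F. \<bar>real_of_int (snd x)\<bar>)"
  define \<phi> where "\<phi> w = superharmonic_weight \<beta> w + C" for w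
  have C: "0 \<le> C" by (simp add: C_def sum_nonneg)
  have weight_nonneg: "0 \<le> superharmonic_weight \<beta> w" for w
    using superharmonic_weight_ge [OF \<beta>, of w] by (rule order_trans [rotated]) simp
  have bound: "real_of_int (snd w) \<le> \<phi> w" if "w \<in> A" for w
  proof (cases "w \<in> F")
    case True
    then have "\<bar>real_of_int (snd w)\<bar> \<le> C"
      unfolding C_def using \<open>finite F\<close> by (intro member_le_sum) auto
    then show ?thesis using weight_nonneg [of w] by (simp add: \<phi>_def)
  next
    case False
    then have "real_of_int (snd w) \<le> \<bar>real_of_int (fst w)\<bar> powr \<beta>"
      using that by (auto simp: A_def F_def line_def)
    then show ?thesis using superharmonic_weight_ge [OF \<beta>, of w] C by (simp add: \<phi>_def)
  qed
  obtain R :: nat where R: "0 < R" "\<phi> (0, int R) < R"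
    using superharmonic_weight_sublinear [OF \<beta>, of C] by (auto simp: \<phi>_def)
  define gr where "gr N = green A (line (int N) - B)" for N
  \<comment> \<open>The constant \<open>c\<close> must not depend on \<open>N\<close>, since
    \<open>Hbar_pos\<close> needs a bound that survives the limit.\<close>
  define pos where "pos w \<longleftrightarrow> (\<exists>c>0. eventually (\<lambda>N. c \<le> gr N w) sequentially)" for w
  have lower: "ennreal (4 * (min (real N) (real_of_int (snd w)) - \<phi> w)) \<le> gr N w" if "N > 0" for N w
    unfolding gr_def
  proof (rule green_line_ge)
    show "finite {w. \<phi> w < real N}"
      using finite_superharmonic_weight_less [OF \<beta>, of "N - C"] by (simp add: \<phi>_def algebra_simps)
    show "\<phi> (w + (1,0)) + \<phi> (w + (-1,0)) + \<phi> (w + (0,1)) + \<phi> (w + (0,-1)) < 4 * \<phi> w"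
      if "0 < snd w" for w
      using superharmonic_weight_strict [OF \<beta> that] unfolding \<phi>_def by argo
    show "real_of_int (snd w) \<le> \<phi> w" if "w \<in> A" for w
      using that by (rule bound)
    show "0 \<le> \<phi> w" for w
      using weight_nonneg [of w] C by (simp add: \<phi>_def)
  qed (use that in \<open>auto simp: A_def\<close>)
  have "pos (0, int R)"
    unfolding pos_def
  proof (intro exI conjI)
    show "0 < ennreal (4 * (R - \<phi> (0, int R)))" using R by simp
    show "eventually (\<lambda>N. ennreal (4 * (R - \<phi> (0, int R))) \<le> gr N (0, int R)) sequentially"
      using eventually_ge_at_top [of R]
    proof eventually_elim
      case (elim N)
      then show ?case using lower [of N "(0, int R)"] R by (simp add: min_absorb2)
    qed
  qed
  \<comment> \<open>A neighbour in \<open>B\<close> would have positive harmonic measure, contrary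
    to \<open>none\<close>. A neighbour of positive height is then off \<open>A\<close>, so its
    \<open>green\<close> dominates its average and keeps a quarter of the bound.\<close>
  have nb: "w + e \<notin> B \<and> (0 < snd (w + e) \<longrightarrow> pos (w + e))"
    if "pos w" and e: "e \<in> {(1,0), (-1,0), (0,1), (0,-1)}" for w e
  proof -
    from \<open>pos w\<close> obtain c where c: "0 < c" "eventually (\<lambda>N. c \<le> gr N w) sequentially"
      by (auto simp: pos_def)
    have "0 < c / 4" using c by (simp add: ennreal_zero_less_divide)
    have avg: "eventually (\<lambda>N. c / 4 \<le> avg (gr N) (w + e)) sequentially"
      using c(2)
    proof eventually_elim
      case (elim N)
      have "- e \<in> {(1,0), (-1,0), (0,1), (0,-1)}" using e by auto
      then have "gr N w / 4 \<le> avg (gr N) (w + e)"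
        using avg_ge_neighbour [of "- e" "gr N" "w + e"] by simp
      with elim show ?case by (meson divide_right_mono_ennreal order_trans)
    qed
    have "w + e \<notin> B"
    proof
      assume "w + e \<in> B"
      have "eventually (\<lambda>N. c / 4 \<le> Hbar_N B N (w + e)) sequentially"
        using avg eventually_gt_at_top [of 0]
        by eventually_elim (simp add: Hbar_N_eq_green \<open>w + e \<in> B\<close> gr_def A_def)
      from Hbar_pos [OF \<open>w + e \<in> B\<close> \<open>0 < c / 4\<close> this] none \<open>w + e \<in> B\<close> show False by blast
    qed
    moreover have "pos (w + e)" if "0 < snd (w + e)"
    proof -
      have "w + e \<notin> A" using \<open>w + e \<notin> B\<close> that by (auto simp: A_def line_def)
      then have "avg (gr N) (w + e) \<le> gr N (w + e)" for N
        using green_unfold [of A "line (int N) - B" "w + e"] by (simp add: gr_def)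
      then have "eventually (\<lambda>N. c / 4 \<le> gr N (w + e)) sequentially"
        using avg by (auto elim!: eventually_mono intro: order_trans)
      with \<open>0 < c / 4\<close> show ?thesis unfolding pos_def by blast
    qed
    ultimately show ?thesis by blast
  qed
  have right: "pos (int k, int R)" and left: "pos (- int k, int R)" for k
  proof (induction k)
    case (Suc k)
    { case 1 show ?case using nb [OF Suc(1), of "(1,0)"] R by (simp add: algebra_simps) }
    { case 2 show ?case using nb [OF Suc(2), of "(-1,0)"] R by (simp add: algebra_simps) }
  qed (use \<open>pos (0, int R)\<close> in simp_all)
  have row: "pos (a, int R)" for a
    using right [of "nat a"] left [of "nat (- a)"] by (cases "0 \<le> a") auto
  have up: "pos (a, int (R + k))" for a k
  proof (induction k)
    case (Suc k)
    then show ?case using nb [OF Suc, of "(0,1)"] by (simp add: add_ac)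
  qed (simp add: row)
  have down: "pos (a, int (R - k))" if "k < R" for a k
    using that
  proof (induction k)
    case (Suc k)
    then show ?case using nb [of "(a, int (R - k))" "(0,-1)"] by (simp add: of_nat_diff algebra_simps)
  qed (simp add: row)
  \<comment> \<open>Starting on the axis at height \<open>R\<close>, the row and then the columns
    sweep out all points of positive height.\<close>
  have all: "pos (a, int m)" if "0 < m" for a m
    using up [of a "m - R"] down [of "R - m" a] that by (cases "R \<le> m") auto
  obtain a b where ab: "(a, b) \<in> B" "0 \<le> b"
    using assms(1,2) unfolding HH_def by fastforce
  \<comment> \<open>The point above \<open>(a, b)\<close> has positive height even if
    \<open>b = 0\<close>, so the step down from it reaches \<open>B\<close>, which \<open>nb\<close>
    excludes.\<close>
  have "(a, b + 1) + (0, -1) \<notin> B"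
    using nb [OF all [of "Suc (nat b)" a], of "(0,-1)"] ab by simp
  with ab show False by simp
qed

end
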